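(* Let $Q\subset\mathbb{R}^N$ be a cube and $u\in BMO(Q)$. Define for $\sigma\in[0,\infty)$ $$S_\sigma:=\{x\in Q : |u(x)-u_Q|>\sigma\}.$$ Then $$\mathcal{L}^N(S_\sigma)\le \gamma\, e^{-\alpha\frac{\sigma-\eta}{\|u\|_{BMO(Q)}}}\,\mathcal{L}^N(S_\eta)\qquad\text{for all } 0\le\eta\le\sigma .$$ Here $\gamma=\gamma(N)$ and $\alpha=\alpha(N)$ are positive constants depending only on the dimension $N$.
   Context: $N$ is a natural number and $\mathcal{L}^N$ is Lebesgue measure on $\mathbb{R}^N$. A cube is a Cartesian product $\prod_{i=1}^N J_i$ of non-empty closed bounded intervals of the same length. For a measurable set $A$ of finite positive measure and $u\in L^1(A)$, $u_A:=\frac{1}{\mathcal{L}^N(A)}\int_A u(z)\,dz$. For a cube $Q$ and a real-valued $u\in L^1(Q)$, $u\in BMO(Q)$ means that $$\|u\|_{BMO(Q)}:=\sup\left\{\frac{1}{\mathcal{L}^N(C)^2}\int_C\int_C|u(z)-u(x)|\,dz\,dx : C\subset Q\text{ a cube}\right\}<\infty .$$ *)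

theory Defs
  imports "HOL-Analysis.Analysis"
begin

definition is_cube :: "(real ^ 'n) set \<Rightarrow> bool" where
  "is_cube C \<longleftrightarrow> (\<exists>a l. 0 \<le> l \<and> C = cbox a (\<chi> i. a $ i + l))"

definition mean_on :: "(real ^ 'n) set \<Rightarrow> (real ^ 'n \<Rightarrow> real) \<Rightarrow> real" where
  "mean_on A u = (1 / measure lebesgue A) * (LINT z:A|lebesgue. u z)"

text \<open>
  A one-point cube contributes 0 to the supremum, because division by 0 yields 0.
  The Bochner integrals below carry their usual meaning for \<open>u\<close> integrable over \<open>Q\<close>,
  which \<open>in_BMO\<close> requires.
\<close>

definition BMO_norm :: "(real ^ 'n) set \<Rightarrow> (real ^ 'n \<Rightarrow> real) \<Rightarrow> ereal" where
  "BMO_norm Q u =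
     (SUP C \<in> {C. is_cube C \<and> C \<subseteq> Q}.
        ereal (1 / (measure lebesgue C)\<^sup>2 *
          (LINT x:C|lebesgue. (LINT z:C|lebesgue. \<bar>u z - u x\<bar>))))"

definition in_BMO :: "(real ^ 'n) set \<Rightarrow> (real ^ 'n \<Rightarrow> real) \<Rightarrow> bool" where
  "in_BMO Q u \<longleftrightarrow> set_integrable lebesgue Q u \<and> BMO_norm Q u < \<infinity>"

definition superlevel :: "(real ^ 'n) set \<Rightarrow> (real ^ 'n \<Rightarrow> real) \<Rightarrow> real \<Rightarrow> (real ^ 'n) set" where
  "superlevel Q u \<sigma> = {x \<in> Q. \<bar>u x - mean_on Q u\<bar> > \<sigma>}"

end

theory Submission
  imports Defs
begin

text \<open>
  With \<open>\<delta> = 2\<^sup>N\<^sup>+\<^sup>3 \<parallel>u\<parallel>\<close>, already the measure of \<open>S\<^bsub>t + \<delta>\<^esub>\<close> is at most half that of \<open>S\<^sub>t\<close>,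
  for every \<open>t \<ge> 0\<close>; iterating this gives the theorem. To see it, stop the dyadic
  subdivision of \<open>Q\<close> at the first cubes in which \<open>S\<^sub>t\<close> has density at least \<open>2\<^sup>-\<^sup>N\<^sup>-\<^sup>1\<close>. These cubes
  cover almost all of \<open>S\<^sub>t\<close>. If such a cube \<open>C\<close> is not \<open>Q\<close> itself, its parent was not stopped,
  so \<open>S\<^sub>t\<close> fills at most half of \<open>C\<close>. Since \<open>u\<close> differs by at least \<open>\<delta>\<close> between a point of
  \<open>S\<^bsub>t + \<delta>\<^esub>\<close> and a point outside \<open>S\<^sub>t\<close>, the mean oscillation on \<open>C\<close> bounds the measure of
  \<open>S\<^bsub>t + \<delta>\<^esub>\<close> in \<open>C\<close> by \<open>2\<^sup>-\<^sup>N\<^sup>-\<^sup>2\<close> times that of \<open>C\<close>, hence by half the measure of \<open>S\<^sub>t\<close> in \<open>C\<close>. On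
  \<open>C = Q\<close> the distance to the mean takes over the role of the complement of \<open>S\<^sub>t\<close>.
\<close>

section \<open>Dyadic cells\<close>

text \<open>The half-open cell of level \<open>n\<close> around \<open>x\<close> in the grid of side
  \<open>l / 2 ^ n\<close> through \<open>a\<close>. Half-open cells of one level partition the
  whole space exactly, and naming a cell by any of its points avoids integer indices.\<close>

definition dyadic :: "real ^ 'n \<Rightarrow> real \<Rightarrow> nat \<Rightarrow> real ^ 'n \<Rightarrow> (real ^ 'n) set" where
  "dyadic a l n x = {y. \<forall>i. \<lfloor>2 ^ n * ((y $ i - a $ i) / l)\<rfloor> = \<lfloor>2 ^ n * ((x $ i - a $ i) / l)\<rfloor>}"

lemma dyadic_self: "x \<in> dyadic a l n x"
  by (simp add: dyadic_def)

lemma dyadic_eq: "y \<in> dyadic a l n x \<Longrightarrow> dyadic a l n y = dyadic a l n x"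
  by (simp add: dyadic_def)

text \<open>Passing to a coarser level is an integer division of the grid coordinate by
  \<open>2 ^ (n - m)\<close>. This is what makes the cells nested.\<close>

lemma floor_power2_mult_eq:
  fixes s t :: real
  assumes "\<lfloor>2 ^ n * s\<rfloor> = \<lfloor>2 ^ n * t\<rfloor>" "m \<le> n"
  shows "\<lfloor>2 ^ m * s\<rfloor> = \<lfloor>2 ^ m * t\<rfloor>"
proof -
  have *: "\<lfloor>2 ^ m * r\<rfloor> = \<lfloor>2 ^ n * r\<rfloor> div 2 ^ (n - m)" for r :: real
  proof -
    have "(2 :: real) ^ n = 2 ^ m * 2 ^ (n - m)"
      using assms(2) by (simp flip: power_add)
    then have "2 ^ m * r = 2 ^ n * r / real_of_int (2 ^ (n - m))"
      by simp
    then show ?thesis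
      using floor_divide_real_eq_div[of "2 ^ (n - m)" "2 ^ n * r"] by simp
  qed
  show ?thesis
    using assms(1) by (simp add: *)
qed

lemma dyadic_antimono: "m \<le> n \<Longrightarrow> dyadic a l n x \<subseteq> dyadic a l m x"
  unfolding dyadic_def using floor_power2_mult_eq by blast

text \<open>A cell is determined by its vector of integer grid coordinates, and there are only
  countably many of those.\<close>

lemma countable_range_dyadic: "countable (range (dyadic a l n :: real ^ 'n \<Rightarrow> _))"
proof -
  define F where "F k = {y :: real ^ 'n. \<forall>i. \<lfloor>2 ^ n * ((y $ i - a $ i) / l)\<rfloor> = k $ i}"
    for k :: "int ^ 'n"
  have "dyadic a l n x = F (\<chi> i. \<lfloor>2 ^ n * ((x $ i - a $ i) / l)\<rfloor>)" for x
    by (simp add: dyadic_def F_def)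
  then have "range (dyadic a l n) \<subseteq> range F"
    by blast
  then show ?thesis
    by (rule countable_subset) simp
qed

lemma dyadic_sandwich:
  fixes a x :: "real ^ 'n"
  assumes "0 < l"
  obtains c where "box c (\<chi> i. c $ i + l / 2 ^ n) \<subseteq> dyadic a l n x"
    "dyadic a l n x \<subseteq> cbox c (\<chi> i. c $ i + l / 2 ^ n)"
proof
  \<comment> \<open>The lower corner of the cell: the grid point below \<open>x\<close> in every
    coordinate.\<close>
  define c where "c = (\<chi> i. a $ i + l / 2 ^ n * \<lfloor>2 ^ n * ((x $ i - a $ i) / l)\<rfloor>)"
  have *: "\<lfloor>2 ^ n * ((y $ i - a $ i) / l)\<rfloor> = \<lfloor>2 ^ n * ((x $ i - a $ i) / l)\<rfloor> \<longleftrightarrow>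
      c $ i \<le> y $ i \<and> y $ i < c $ i + l / 2 ^ n" for y :: "real ^ 'n" and i
    using assms unfolding floor_eq_iff c_def by (simp add: field_simps)
  show "box c (\<chi> i. c $ i + l / 2 ^ n) \<subseteq> dyadic a l n x"
    unfolding dyadic_def * by (auto simp: mem_box_cart less_imp_le)
  show "dyadic a l n x \<subseteq> cbox c (\<chi> i. c $ i + l / 2 ^ n)"
    unfolding dyadic_def * by (auto simp: mem_box_cart less_imp_le)
qed

text \<open>At level 0 the corner has to be \<open>a\<close> itself, so that the cell of
  \<open>a\<close> is the given cube without its upper faces.\<close>

lemma dyadic_zero_sandwich:
  fixes a :: "real ^ 'n"
  assumes "0 < l"
  shows "box a (\<chi> i. a $ i + l) \<subseteq> dyadic a l 0 a" "dyadic a l 0 a \<subseteq> cbox a (\<chi> i. a $ i + l)"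
proof -
  have *: "\<lfloor>2 ^ 0 * ((y $ i - a $ i) / l)\<rfloor> = \<lfloor>2 ^ 0 * ((a $ i - a $ i) / l)\<rfloor> \<longleftrightarrow>
      a $ i \<le> y $ i \<and> y $ i < a $ i + l" for y :: "real ^ 'n" and i
    using assms unfolding floor_eq_iff by (simp add: field_simps)
  show "box a (\<chi> i. a $ i + l) \<subseteq> dyadic a l 0 a" "dyadic a l 0 a \<subseteq> cbox a (\<chi> i. a $ i + l)"
    unfolding dyadic_def * by (auto simp: mem_box_cart less_imp_le)
qed

section \<open>Measure and size of the cells\<close>

lemma between_box_cbox:
  fixes c d :: "'a :: euclidean_space"
  assumes "box c d \<subseteq> D" "D \<subseteq> cbox c d"
  shows "D \<in> lmeasurable" "measure lebesgue D = measure lebesgue (cbox c d)" "negligible (cbox c d - D)"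
proof -
  have neg: "negligible (cbox c d - box c d)"
    by (rule negligible_frontier_interval)
  show neg2: "negligible (cbox c d - D)"
    by (rule negligible_subset[OF neg]) (use assms in blast)
  show "D \<in> lmeasurable"
    by (rule lmeasurable_negligible_symdiff[of "cbox c d"]) (use neg2 assms in \<open>auto simp: Diff_eq_empty_iff[THEN iffD2]\<close>)
  show "measure lebesgue D = measure lebesgue (cbox c d)"
    by (rule measure_negligible_symdiff) (use neg2 assms in \<open>auto simp: Diff_eq_empty_iff[THEN iffD2]\<close>)
qed

lemma measure_cube:
  fixes a :: "real ^ 'n"
  assumes "0 \<le> l"
  shows "measure lebesgue (cbox a (\<chi> i. a $ i + l)) = l ^ CARD('n)"
  using assms content_cbox_cart[of a "\<chi> i. a $ i + l"]
  by (simp add: measure_completion interval_eq_empty_cart not_less)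

lemma dyadic_lmeasurable: "0 < l \<Longrightarrow> dyadic a l n x \<in> lmeasurable"
  by (erule dyadic_sandwich) (rule between_box_cbox(1))

lemma measure_dyadic:
  fixes a x :: "real ^ 'n"
  assumes "0 < l"
  shows "measure lebesgue (dyadic a l n x) = (l / 2 ^ n) ^ CARD('n)"
proof -
  obtain c where "box c (\<chi> i. c $ i + l / 2 ^ n) \<subseteq> dyadic a l n x"
    "dyadic a l n x \<subseteq> cbox c (\<chi> i. c $ i + l / 2 ^ n)"
    using dyadic_sandwich assms by blast
  from between_box_cbox(2)[OF this] show ?thesis
    using assms measure_cube[of "l / 2 ^ n" c] by simp
qed

text \<open>The BMO norm tests closed cubes only, so a cell is replaced by its closure, which adds a
  null set.\<close>

lemma dyadic_closed_cube:
  fixes a x :: "real ^ 'n"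
  assumes "0 < l" "x \<in> dyadic a l 0 a"
  obtains C where "is_cube C" "C \<subseteq> cbox a (\<chi> i. a $ i + l)" "dyadic a l n x \<subseteq> C"
    "negligible (C - dyadic a l n x)" "C \<in> lmeasurable"
    "measure lebesgue C = measure lebesgue (dyadic a l n x)"
proof -
  obtain c where c: "box c (\<chi> i. c $ i + l / 2 ^ n) \<subseteq> dyadic a l n x"
    "dyadic a l n x \<subseteq> cbox c (\<chi> i. c $ i + l / 2 ^ n)"
    using dyadic_sandwich assms(1) by blast
  have "dyadic a l n x \<subseteq> dyadic a l 0 a"
    using dyadic_antimono[of 0 n a l x] dyadic_eq[OF assms(2)] by simp
  \<comment> \<open>The closed cube is the closure of its open interior, so it stays within the
    closed cube that contains the cell.\<close>
  then have "closure (box c (\<chi> i. c $ i + l / 2 ^ n)) \<subseteq> cbox a (\<chi> i. a $ i + l)"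
    using dyadic_zero_sandwich(2)[OF assms(1), of a] c(1) by (intro closure_minimal) auto
  moreover have "box c (\<chi> i. c $ i + l / 2 ^ n) \<noteq> {}"
    using assms(1) by (simp add: interval_eq_empty_cart not_le)
  ultimately have "cbox c (\<chi> i. c $ i + l / 2 ^ n) \<subseteq> cbox a (\<chi> i. a $ i + l)"
    by (simp add: closure_box)
  moreover have "is_cube (cbox c (\<chi> i. c $ i + l / 2 ^ n))"
    unfolding is_cube_def using assms(1) by (intro exI[of _ c] exI[of _ "l / 2 ^ n"]) auto
  ultimately show ?thesis
    using that c between_box_cbox[OF c] by simp
qed

lemma dyadic_subset_ball:
  fixes a x :: "real ^ 'n"
  assumes "0 < l" "0 < e"
  obtains n where "dyadic a l n x \<subseteq> ball x e"
proof -
  obtain n :: nat where n: "real CARD('n) * l / e < 2 ^ n"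
    using real_arch_pow[of 2 "real CARD('n) * l / e"] by auto
  have "dyadic a l n x \<subseteq> ball x e"
  proof
    fix y assume y: "y \<in> dyadic a l n x"
    obtain c where "dyadic a l n x \<subseteq> cbox c (\<chi> i. c $ i + l / 2 ^ n)"
      using dyadic_sandwich assms(1) by blast
    then have "x \<in> cbox c (\<chi> i. c $ i + l / 2 ^ n)" "y \<in> cbox c (\<chi> i. c $ i + l / 2 ^ n)"
      using y dyadic_self[of x a l n] by blast+
    then have "c $ i \<le> x $ i \<and> x $ i \<le> c $ i + l / 2 ^ n \<and> c $ i \<le> y $ i \<and> y $ i \<le> c $ i + l / 2 ^ n" for i
      by (simp add: mem_box_cart)
    then have "\<bar>(x - y) $ i\<bar> \<le> l / 2 ^ n" for i
      unfolding vector_minus_component abs_le_iff by (smt (verit))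
    then have "norm (x - y) \<le> (\<Sum>i\<in>(UNIV :: 'n set). l / 2 ^ n)"
      by (intro order_trans[OF norm_le_l1_cart] sum_mono)
    also have "\<dots> < e"
      using n assms by (simp add: field_simps)
    finally show "y \<in> ball x e"
      by (simp add: dist_norm)
  qed
  then show ?thesis
    by (rule that)
qed

section \<open>Stopping cells\<close>

text \<open>The maximal cells with property \<open>P\<close>: the cells
  \<open>dyadic a l m x\<close> with \<open>m < n\<close> are the ancestors of
  \<open>dyadic a l n x\<close>.\<close>

definition stopping :: "real ^ 'n \<Rightarrow> real \<Rightarrow> ((real ^ 'n) set \<Rightarrow> bool) \<Rightarrow> (real ^ 'n) set set" where
  "stopping a l P =
     {D. \<exists>n x. D = dyadic a l n x \<and> P D \<and> (\<forall>m<n. \<not> P (dyadic a l m x))}"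

lemma countable_stopping: "countable (stopping a l P)"
proof (rule countable_subset)
  show "stopping a l P \<subseteq> (\<Union>n. range (dyadic a l n))"
    by (auto simp: stopping_def)
qed (simp add: countable_range_dyadic)

text \<open>Two stopping cells with a common point \<open>z\<close> are both cells of
  \<open>z\<close>, each at the least level where \<open>P\<close> holds, so their levels
  agree.\<close>

lemma disjoint_stopping: "disjoint (stopping a l P)"
proof (rule disjointI)
  fix A B assume AB: "A \<in> stopping a l P" "B \<in> stopping a l P" "A \<noteq> B"
  show "A \<inter> B = {}"
  proof (rule ccontr)
    assume "A \<inter> B \<noteq> {}"
    then obtain z where z: "z \<in> A" "z \<in> B"
      by blast
    have "\<exists>n. D = dyadic a l n z \<and> P (dyadic a l n z) \<and> (\<forall>m<n. \<not> P (dyadic a l m z))"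
      if D: "D \<in> stopping a l P" "z \<in> D" for D
    proof -
      obtain n x where n: "D = dyadic a l n x" "P D" "\<forall>m<n. \<not> P (dyadic a l m x)"
        using D unfolding stopping_def by blast
      have "dyadic a l m z = dyadic a l m x" if "m \<le> n" for m
        using dyadic_antimono[OF that] D(2) n(1) by (intro dyadic_eq) blast
      then show ?thesis
        using n by (intro exI[of _ n]) auto
    qed
    from this[OF AB(1) z(1)] this[OF AB(2) z(2)] obtain m n where
      m: "A = dyadic a l m z" "P (dyadic a l m z)" "\<forall>k<m. \<not> P (dyadic a l k z)" and
      n: "B = dyadic a l n z" "P (dyadic a l n z)" "\<forall>k<n. \<not> P (dyadic a l k z)"
      by blast
    then have "m = n"
      by (meson nat_neq_iff)
    then show False
      using AB(3) m(1) n(1) by simp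
  qed
qed

lemma stopping_covers:
  assumes "P (dyadic a l n x)"
  shows "x \<in> \<Union>(stopping a l P)"
proof -
  define k where "k = (LEAST n. P (dyadic a l n x))"
  have "P (dyadic a l k x)"
    unfolding k_def using assms by (rule LeastI)
  moreover have "\<not> P (dyadic a l m x)" if "m < k" for m
    using that unfolding k_def by (rule not_less_Least)
  ultimately have "dyadic a l k x \<in> stopping a l P"
    unfolding stopping_def by blast
  then show ?thesis
    using dyadic_self by blast
qed

section \<open>Summation over cells and a density argument\<close>

text \<open>Countable additivity turns the estimates on the pieces into a global one. The sums are
  taken in \<open>ennreal\<close>, where summability is no issue; only \<open>A\<close> has to be
  covered by the pieces.\<close>

lemma measure_le_by_partition:
  assumes "countable \<D>" "disjoint \<D>" "\<And>D. D \<in> \<D> \<Longrightarrow> D \<in> sets M"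
    and A: "A \<in> fmeasurable M" and B: "B \<in> fmeasurable M" and "0 \<le> c" "A \<subseteq> \<Union>\<D>"
    and le: "\<And>D. D \<in> \<D> \<Longrightarrow> measure M (A \<inter> D) \<le> c * measure M (B \<inter> D)"
  shows "measure M A \<le> c * measure M B"
proof -
  have em: "emeasure M (\<Union>D\<in>\<D>. X \<inter> D) = (\<integral>\<^sup>+D. emeasure M (X \<inter> D) \<partial>count_space \<D>)"
    if "X \<in> fmeasurable M" for X
  proof (rule emeasure_UN_countable)
    show "disjoint_family_on ((\<inter>) X) \<D>"
      using assms(2) by (auto simp: disjoint_family_on_def disjoint_def)
  qed (use that assms(1,3) in auto)
  have "emeasure M A = emeasure M (\<Union>D\<in>\<D>. A \<inter> D)"
    using \<open>A \<subseteq> \<Union>\<D>\<close> by (intro arg_cong[of _ _ "emeasure M"]) blast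
  also have "\<dots> = (\<integral>\<^sup>+D. emeasure M (A \<inter> D) \<partial>count_space \<D>)"
    by (rule em[OF A])
  also have "\<dots> \<le> (\<integral>\<^sup>+D. ennreal c * emeasure M (B \<inter> D) \<partial>count_space \<D>)"
  proof (rule nn_integral_mono)
    fix D assume "D \<in> space (count_space \<D>)"
    then have D: "D \<in> \<D>"
      by simp
    then have "A \<inter> D \<in> fmeasurable M" "B \<inter> D \<in> fmeasurable M"
      using assms(3) A B by (auto intro: fmeasurable_Int_fmeasurable)
    then show "emeasure M (A \<inter> D) \<le> ennreal c * emeasure M (B \<inter> D)"
      using le[OF D] \<open>0 \<le> c\<close>
      by (simp add: emeasure_eq_measure2 ennreal_mult[symmetric] ennreal_leI)
  qed
  also have "\<dots> = ennreal c * emeasure M (\<Union>D\<in>\<D>. B \<inter> D)"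
    unfolding em[OF B] by (simp add: nn_integral_cmult)
  also have "\<dots> \<le> ennreal c * emeasure M B"
    using B by (intro mult_left_mono emeasure_mono) auto
  finally show ?thesis
    using A B \<open>0 \<le> c\<close> by (simp add: emeasure_eq_measure2 ennreal_mult[symmetric])
qed

text \<open>
  The part of the Lebesgue density theorem that is needed: an open superset of \<open>B\<close> with nearly
  the same measure is split into stopping cells, so \<open>B\<close> cannot be thin in all of them.
\<close>

lemma negligible_if_thin_dyadic:
  fixes B :: "(real ^ 'n) set"
  assumes "0 < l" "B \<in> lmeasurable" "0 \<le> \<theta>" "\<theta> < 1"
    and thin: "\<And>n x. x \<in> B \<Longrightarrow>
      measure lebesgue (B \<inter> dyadic a l n x) \<le> \<theta> * measure lebesgue (dyadic a l n x)"
  shows "negligible B"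
proof -
  have *: "measure lebesgue B \<le> \<theta> * (measure lebesgue B + e)" if "0 < e" for e
  proof -
    obtain U where U: "open U" "B \<subseteq> U" "U \<in> lmeasurable" "measure lebesgue U < measure lebesgue B + e"
    proof -
      obtain U where U: "open U" "B \<subseteq> U" "U - B \<in> lmeasurable" "emeasure lebesgue (U - B) < ennreal e"
        using sets_lebesgue_outer_open[OF fmeasurableD[OF assms(2)] \<open>0 < e\<close>] by blast
      have eq: "U = B \<union> (U - B)"
        using U(2) by blast
      have "U \<in> lmeasurable"
        by (subst eq) (intro fmeasurable.Un assms(2) U(3))
      moreover have "measure lebesgue U = measure lebesgue B + measure lebesgue (U - B)"
        by (subst eq, rule measure_Un3[THEN trans]) (use assms(2) U(3) in \<open>auto simp: Int_Diff\<close>)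
      moreover have "measure lebesgue (U - B) < e"
        using U(3,4) \<open>0 < e\<close> by (simp add: emeasure_eq_measure2 ennreal_less_iff)
      ultimately show ?thesis
        using U(1,2) that by simp
    qed
    \<comment> \<open>The maximal cells inside \<open>U\<close> split all of \<open>U\<close> that
      matters: small cells around a point of the open set \<open>U\<close> lie in
      \<open>U\<close>.\<close>
    let ?\<D> = "stopping a l (\<lambda>D. D \<subseteq> U)"
    have "measure lebesgue B \<le> \<theta> * measure lebesgue U"
    proof (rule measure_le_by_partition[OF countable_stopping disjoint_stopping])
      show "B \<subseteq> \<Union>?\<D>"
      proof
        fix x assume "x \<in> B"
        then obtain r where "0 < r" "ball x r \<subseteq> U"
          using U(1,2) open_contains_ball by blast
        moreover obtain n where "dyadic a l n x \<subseteq> ball x r"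
          using dyadic_subset_ball assms(1) \<open>0 < r\<close> by blast
        ultimately show "x \<in> \<Union>?\<D>"
          by (intro stopping_covers[where n = n]) blast
      qed
      fix D assume "D \<in> ?\<D>"
      then obtain n x where D: "D = dyadic a l n x" "D \<subseteq> U"
        by (auto simp: stopping_def)
      then show "D \<in> sets lebesgue"
        using dyadic_lmeasurable[OF assms(1)] by blast
      show "measure lebesgue (B \<inter> D) \<le> \<theta> * measure lebesgue (U \<inter> D)"
      proof (cases "B \<inter> D = {}")
        case True
        then show ?thesis using \<open>0 \<le> \<theta>\<close> by simp
      next
        \<comment> \<open>Thinness is assumed only for cells named by a point of \<open>B\<close>,
          so the cell is renamed by such a point.\<close>
        case False
        then obtain y where "y \<in> B" "y \<in> D" by blast
        then show ?thesis
          using thin[of y n] D dyadic_eq[of y a l n x] by (simp add: Int_absorb1)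
      qed
    qed (use assms U in auto)
    also have "\<dots> \<le> \<theta> * (measure lebesgue B + e)"
      using U(4) \<open>0 \<le> \<theta>\<close> by (intro mult_left_mono) auto
    finally show ?thesis .
  qed
  \<comment> \<open>Letting \<open>e\<close> tend to 0 leaves an inequality that, with \<theta> < 1,
    forces measure 0.\<close>
  have "measure lebesgue B \<le> \<theta> * measure lebesgue B"
  proof (rule field_le_epsilon)
    fix e :: real assume "0 < e"
    have "\<theta> * e \<le> e"
      using \<open>0 < e\<close> \<open>\<theta> < 1\<close> by simp
    then show "measure lebesgue B \<le> \<theta> * measure lebesgue B + e"
      using *[OF \<open>0 < e\<close>] by (simp add: distrib_left)
  qed
  then have "(1 - \<theta>) * measure lebesgue B \<le> 0"
    by (simp add: algebra_simps)
  then have "measure lebesgue B = 0"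
    using \<open>\<theta> < 1\<close> measure_nonneg[of lebesgue B] by (simp add: mult_le_0_iff)
  then show ?thesis
    using assms(2) negligible_iff_measure by blast
qed

section \<open>Mean oscillation\<close>

text \<open>Chebyshev's inequality, with the superlevel set replaced by any measurable
  \<open>Z\<close> on which the lower bound is known.\<close>

lemma const_mult_measure_le_set_integral:
  fixes f :: "'a \<Rightarrow> real"
  assumes "C \<in> fmeasurable M" and f: "set_integrable M C f" and Z: "Z \<in> sets M" "Z \<subseteq> C"
    and nonneg: "\<And>x. x \<in> C \<Longrightarrow> 0 \<le> f x" and lower: "\<And>x. x \<in> Z \<Longrightarrow> \<kappa> \<le> f x"
  shows "\<kappa> * measure M Z \<le> (LINT x:C|M. f x)"
proof -
  have Z': "Z \<in> fmeasurable M"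
    using fmeasurableI2[OF assms(1) Z(2,1)] .
  then have int: "integrable M (\<lambda>x. indicator Z x *\<^sub>R \<kappa>)"
    by (intro integrable_scaleR_left) (auto simp: fmeasurable_def)
  have "\<kappa> * measure M Z = (LINT x|M. indicator Z x *\<^sub>R \<kappa>)"
    using Z' by (simp add: fmeasurable_def)
  also have "\<dots> \<le> (LINT x|M. indicator C x *\<^sub>R f x)"
    using f lower nonneg Z(2)
    by (intro integral_mono int) (auto simp: indicator_def set_integrable_def)
  finally show ?thesis
    by (simp add: set_lebesgue_integral_def)
qed

lemma set_integrable_abs_diff_const:
  fixes u :: "'a \<Rightarrow> real"
  assumes "C \<in> fmeasurable M" "set_integrable M C u"
  shows "set_integrable M C (\<lambda>z. \<bar>u z - s\<bar>)"
proof -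
  have "set_integrable M C (\<lambda>_. s)"
    using assms(1) unfolding set_integrable_def
    by (intro integrable_scaleR_left) (auto simp: fmeasurable_def)
  then show ?thesis
    by (intro set_integrable_abs set_integral_diff(1) assms(2))
qed

text \<open>The inner integral depends on \<open>x\<close> only through \<open>u x\<close>: it is
  \<open>h (u x)\<close> with \<open>h\<close> Lipschitz, hence measurable and of at most linear
  growth. Integrability matters because a Bochner integral defaults to 0 without it, and the norm
  would then give no bound.\<close>

lemma set_integrable_integral_abs_diff:
  fixes u :: "'a \<Rightarrow> real"
  assumes C: "C \<in> fmeasurable M" and u: "set_integrable M C u"
  shows "set_integrable M C (\<lambda>x. LINT z:C|M. \<bar>u z - u x\<bar>)"
proof -
  define h where "h s = (LINT z:C|M. \<bar>u z - s\<bar>)" for s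
  note int = set_integrable_abs_diff_const[OF C u]
  have const: "set_integrable M C (\<lambda>_. s)" and const_eq: "(LINT z:C|M. s) = measure M C * s" for s :: real
    using C unfolding set_integrable_def set_lebesgue_integral_def
    by (auto simp: fmeasurable_def intro!: integrable_scaleR_left)
  have h_le: "h s \<le> h t + measure M C * \<bar>s - t\<bar>" for s t
  proof -
    have "h s \<le> (LINT z:C|M. \<bar>u z - t\<bar> + \<bar>s - t\<bar>)"
      unfolding h_def by (intro set_integral_mono set_integral_add(1) int const) auto
    also have "\<dots> = h t + measure M C * \<bar>s - t\<bar>"
      by (simp add: h_def set_integral_add(2)[OF int const] const_eq)
    finally show ?thesis .
  qed
  have "(measure M C)-lipschitz_on UNIV h"
  proof (rule lipschitz_onI)
    show "dist (h s) (h t) \<le> measure M C * dist s t" for s t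
      using h_le[of s t] h_le[of t s] by (simp add: dist_real_def abs_minus_commute)
  qed simp
  then have [measurable]: "h \<in> borel_measurable borel"
    by (intro borel_measurable_continuous_onI lipschitz_on_continuous_on)
  have u' [measurable]: "(\<lambda>x. indicator C x *\<^sub>R u x) \<in> borel_measurable M"
    using u by (simp add: set_integrable_def)
  have [measurable]: "C \<in> sets M"
    using C by auto
  have h_nonneg: "0 \<le> h s" for s
    unfolding h_def set_lebesgue_integral_def by (intro integral_nonneg_AE) auto
  have "set_integrable M C (\<lambda>x. h 0 + measure M C * \<bar>u x\<bar>)"
    by (intro set_integral_add(1) const set_integrable_mult_right set_integrable_abs u)
  then have "integrable M (\<lambda>x. indicator C x *\<^sub>R (h 0 + measure M C * \<bar>u x\<bar>))"
    by (simp add: set_integrable_def)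
  then have "integrable M (\<lambda>x. indicator C x *\<^sub>R h (u x))"
  proof (rule Bochner_Integration.integrable_bound)
    \<comment> \<open>Measurability is known only for \<open>u\<close> cut off outside
      \<open>C\<close>; the outer indicator hides the change of argument.\<close>
    have "(\<lambda>x. indicator C x *\<^sub>R h (u x)) = (\<lambda>x. indicator C x *\<^sub>R h (indicator C x *\<^sub>R u x))"
      by (auto simp: indicator_def)
    moreover have "(\<lambda>x. indicator C x *\<^sub>R h (indicator C x *\<^sub>R u x)) \<in> borel_measurable M"
      using measurable_compose[OF u', of h borel] by (intro borel_measurable_scaleR) auto
    ultimately show "(\<lambda>x. indicator C x *\<^sub>R h (u x)) \<in> borel_measurable M"
      by simp
    show "AE x in M. norm (indicator C x *\<^sub>R h (u x))
        \<le> norm (indicator C x *\<^sub>R (h 0 + measure M C * \<bar>u x\<bar>))"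
    proof (rule AE_I2)
      fix x
      show "norm (indicator C x *\<^sub>R h (u x)) \<le> norm (indicator C x *\<^sub>R (h 0 + measure M C * \<bar>u x\<bar>))"
        using h_le[of "u x" 0] h_nonneg[of "u x"] by (auto simp: indicator_def)
    qed
  qed
  then show ?thesis
    by (simp add: set_integrable_def h_def)
qed

lemma is_cube_lmeasurable: "is_cube C \<Longrightarrow> C \<in> lmeasurable"
  by (auto simp: is_cube_def)

lemma BMO_norm_nonneg:
  assumes "is_cube Q"
  shows "0 \<le> BMO_norm Q u"
proof -
  have "0 \<le> ereal (1 / (measure lebesgue Q)\<^sup>2 *
          (LINT x:Q|lebesgue. (LINT z:Q|lebesgue. \<bar>u z - u x\<bar>)))"
    unfolding set_lebesgue_integral_def by (auto intro!: integral_nonneg_AE mult_nonneg_nonneg)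
  also have "\<dots> \<le> BMO_norm Q u"
    unfolding BMO_norm_def by (rule SUP_upper) (use assms in auto)
  finally show ?thesis .
qed

text \<open>Chebyshev's inequality for the outer integral over \<open>C\<close>, whose value the BMO
  norm controls because \<open>C\<close> is an admissible cube.\<close>

lemma measure_oscillation_le:
  assumes "is_cube Q" "in_BMO Q u" "is_cube C" "C \<subseteq> Q" "0 < measure lebesgue C"
    and F: "F \<in> sets lebesgue" "F \<subseteq> C"
    and lower: "\<And>x. x \<in> F \<Longrightarrow> \<kappa> \<le> (LINT z:C|lebesgue. \<bar>u z - u x\<bar>)"
  shows "\<kappa> * measure lebesgue F \<le> real_of_ereal (BMO_norm Q u) * (measure lebesgue C)\<^sup>2"
proof -
  let ?g = "\<lambda>x. LINT z:C|lebesgue. \<bar>u z - u x\<bar>"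
  let ?I = "LINT x:C|lebesgue. ?g x"
  have C: "C \<in> lmeasurable"
    using assms(3) by (rule is_cube_lmeasurable)
  have "set_integrable lebesgue C u"
    using assms(2,4) C by (auto simp: in_BMO_def intro: set_integrable_subset)
  then have g: "integrable lebesgue (\<lambda>x. indicator C x *\<^sub>R ?g x)"
    using set_integrable_integral_abs_diff[OF C] by (simp add: set_integrable_def)
  have "0 \<le> ?g x" for x
    unfolding set_lebesgue_integral_def by (intro integral_nonneg_AE) auto
  then have "\<kappa> * measure lebesgue F \<le> ?I"
    using C F g lower by (intro const_mult_measure_le_set_integral) (auto simp: set_integrable_def)
  moreover have "1 / (measure lebesgue C)\<^sup>2 * ?I \<le> real_of_ereal (BMO_norm Q u)"
  proof -
    have "ereal (1 / (measure lebesgue C)\<^sup>2 * ?I) \<le> BMO_norm Q u"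
      unfolding BMO_norm_def by (rule SUP_upper) (use assms in auto)
    \<comment> \<open>The norm is nonnegative and finite, so passing to a real number loses
      nothing.\<close>
    moreover have "BMO_norm Q u = ereal (real_of_ereal (BMO_norm Q u))"
      using assms(2) BMO_norm_nonneg[OF assms(1), of u]
      by (subst ereal_real) (auto simp: in_BMO_def)
    ultimately show ?thesis
      by (metis ereal_less_eq(3))
  qed
  ultimately show ?thesis
    using assms(5) by (simp add: field_simps)
qed

text \<open>The integral of \<open>u z - s\<close> over \<open>C\<close> is the measure of
  \<open>C\<close> times \<open>mean_on C u - s\<close>; the triangle inequality for integrals does
  the rest.\<close>

lemma abs_diff_mean_le_oscillation:
  fixes u :: "real ^ 'n \<Rightarrow> real"
  assumes C: "C \<in> lmeasurable" and "0 < measure lebesgue C" and u: "set_integrable lebesgue C u"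
  shows "\<bar>s - mean_on C u\<bar> * measure lebesgue C \<le> (LINT z:C|lebesgue. \<bar>u z - s\<bar>)"
proof -
  have const: "set_integrable lebesgue C (\<lambda>_. s)" and const_eq: "(LINT z:C|lebesgue. s) = measure lebesgue C * s"
    using C unfolding set_integrable_def set_lebesgue_integral_def
    by (auto simp: fmeasurable_def intro!: integrable_scaleR_left)
  have "measure lebesgue C * (mean_on C u - s) = (LINT z:C|lebesgue. u z - s)"
    using assms(2) by (simp add: set_integral_diff(2)[OF u const] const_eq mean_on_def right_diff_distrib)
  moreover have "\<bar>LINT z:C|lebesgue. u z - s\<bar> \<le> (LINT z:C|lebesgue. \<bar>u z - s\<bar>)"
    using set_integral_norm_bound[OF set_integral_diff(1)[OF u const]] by simp
  ultimately have "\<bar>measure lebesgue C * (mean_on C u - s)\<bar> \<le> (LINT z:C|lebesgue. \<bar>u z - s\<bar>)"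
    by simp
  then show ?thesis
    by (simp add: abs_mult abs_minus_commute mult.commute)
qed

section \<open>Decay of the superlevel sets\<close>

lemma superlevel_lmeasurable:
  assumes "is_cube Q" "in_BMO Q u"
  shows "superlevel Q u s \<in> lmeasurable"
proof -
  have Q: "Q \<in> lmeasurable"
    using assms(1) by (rule is_cube_lmeasurable)
  have [measurable]: "(\<lambda>x. indicator Q x *\<^sub>R u x) \<in> borel_measurable lebesgue"
    using assms(2) unfolding in_BMO_def set_integrable_def by (intro borel_measurable_integrable) simp
  have "{x \<in> space lebesgue. s < \<bar>indicator Q x *\<^sub>R u x - mean_on Q u\<bar>} \<in> sets lebesgue"
    by measurable
  then have "Q \<inter> {x \<in> space lebesgue. s < \<bar>indicator Q x *\<^sub>R u x - mean_on Q u\<bar>} \<in> sets lebesgue"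
    using Q by blast
  moreover have "superlevel Q u s = Q \<inter> {x \<in> space lebesgue. s < \<bar>indicator Q x *\<^sub>R u x - mean_on Q u\<bar>}"
    by (auto simp: superlevel_def)
  ultimately show ?thesis
    using fmeasurableI2[OF Q, of "superlevel Q u s"] by (auto simp: superlevel_def)
qed

lemma superlevel_antimono: "s \<le> t \<Longrightarrow> superlevel Q u t \<subseteq> superlevel Q u s"
  by (auto simp: superlevel_def)

lemma measure_superlevel_antimono:
  assumes "is_cube Q" "in_BMO Q u" "s \<le> t"
  shows "measure lebesgue (superlevel Q u t) \<le> measure lebesgue (superlevel Q u s)"
  using assms superlevel_lmeasurable
  by (intro measure_mono_fmeasurable superlevel_antimono) auto

text \<open>For every \<open>x\<close> in the higher superlevel set within \<open>C\<close>, the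
  inner integral is at least \<delta> / 2 times the measure of \<open>C\<close>; the oscillation
  bound then limits how many such \<open>x\<close> there are.\<close>

lemma measure_superlevel_cube_le:
  fixes u :: "real ^ 'n \<Rightarrow> real"
  assumes Q: "is_cube Q" "in_BMO Q u" and C: "is_cube C" "C \<subseteq> Q" "0 < measure lebesgue C"
    and "0 \<le> t" "0 < \<delta>"
    and half: "C = Q \<or> measure lebesgue (superlevel Q u t \<inter> C) \<le> measure lebesgue C / 2"
  shows "\<delta> * measure lebesgue (superlevel Q u (t + \<delta>) \<inter> C)
    \<le> 2 * real_of_ereal (BMO_norm Q u) * measure lebesgue C"
proof -
  let ?m = "measure lebesgue"
  let ?E = "superlevel Q u t" and ?F = "superlevel Q u (t + \<delta>)"
  have Cm: "C \<in> lmeasurable"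
    using C(1) by (rule is_cube_lmeasurable)
  have E: "?E \<in> lmeasurable" and F: "?F \<in> lmeasurable"
    using superlevel_lmeasurable[OF Q] by auto
  have u: "set_integrable lebesgue C u"
    using Q(2) C(2) Cm by (auto simp: in_BMO_def intro: set_integrable_subset)
  have "\<delta> / 2 * ?m C * ?m (?F \<inter> C) \<le> real_of_ereal (BMO_norm Q u) * (?m C)\<^sup>2"
  proof (rule measure_oscillation_le[OF Q C])
    show "?F \<inter> C \<in> sets lebesgue" "?F \<inter> C \<subseteq> C"
      using F Cm by auto
    fix x assume x: "x \<in> ?F \<inter> C"
    show "\<delta> / 2 * ?m C \<le> (LINT z:C|lebesgue. \<bar>u z - u x\<bar>)"
      using half
    proof
      \<comment> \<open>Here \<open>mean_on C u\<close> is the very mean that defines the superlevel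
        sets, so \<open>u x\<close> is far from the average over \<open>C\<close>.\<close>
      assume "C = Q"
      then have "\<delta> / 2 \<le> \<bar>u x - mean_on C u\<bar>"
        using x \<open>0 \<le> t\<close> \<open>0 < \<delta>\<close> by (simp add: superlevel_def)
      then have "\<delta> / 2 * ?m C \<le> \<bar>u x - mean_on C u\<bar> * ?m C"
        using C(3) by (intro mult_right_mono) auto
      then show ?thesis
        using abs_diff_mean_le_oscillation[OF Cm C(3) u, of "u x"] by linarith
    next
      \<comment> \<open>At least half of \<open>C\<close> lies outside \<open>?E\<close>, and there
        \<open>u z\<close> is within \<open>t\<close> of the mean while \<open>u x\<close> is more
        than \<open>t + \<delta>\<close> away.\<close>
      assume "?m (?E \<inter> C) \<le> ?m C / 2"
      moreover have "?m (C - ?E) = ?m C - ?m (C \<inter> ?E)"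
        using Cm E measurable_measure_Diff[of C lebesgue "C \<inter> ?E"]
        by (simp add: Diff_Int_distrib fmeasurableD sets.Int Diff_Int)
      ultimately have "\<delta> / 2 * ?m C \<le> \<delta> * ?m (C - ?E)"
        using \<open>0 < \<delta>\<close> by (simp add: Int_commute)
      also have "\<dots> \<le> (LINT z:C|lebesgue. \<bar>u z - u x\<bar>)"
      proof (rule const_mult_measure_le_set_integral[OF Cm set_integrable_abs_diff_const[OF Cm u]])
        show "C - ?E \<in> sets lebesgue"
          using Cm E by auto
        show "\<delta> \<le> \<bar>u z - u x\<bar>" if "z \<in> C - ?E" for z
          using that x C(2) by (auto simp: superlevel_def)
      qed auto
      finally show ?thesis .
    qed
  qed
  then have "?m C * (\<delta> * ?m (?F \<inter> C)) \<le> ?m C * (2 * real_of_ereal (BMO_norm Q u) * ?m C)"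
    by (simp add: power2_eq_square algebra_simps)
  then show ?thesis
    using C(3) by simp
qed

lemma measure_superlevel_halving:
  fixes u :: "real ^ 'n \<Rightarrow> real"
  assumes "0 < l" and Q_def: "Q = cbox a (\<chi> i. a $ i + l)" and u: "in_BMO Q u" and "0 \<le> t"
    and \<delta>: "\<delta> = 2 ^ (CARD('n) + 3) * real_of_ereal (BMO_norm Q u)" "0 < \<delta>"
  shows "measure lebesgue (superlevel Q u (t + \<delta>)) \<le> 1 / 2 * measure lebesgue (superlevel Q u t)"
proof -
  let ?m = "measure lebesgue"
  define E F where "E = superlevel Q u t" and "F = superlevel Q u (t + \<delta>)"
  define Q' where "Q' = dyadic a l 0 a"
  \<comment> \<open>A child has \<open>1 / 2 ^ N\<close> of its parent's measure, where
    \<open>N = CARD('n)\<close>, so density at most \<theta> in the parent means density at most 1/2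
    in the child.\<close>
  define \<theta> :: real where "\<theta> = 1 / 2 ^ (CARD('n) + 1)"
  \<comment> \<open>Cells tile the whole space; the first conjunct keeps those inside the half-open
    version \<open>Q'\<close> of \<open>Q\<close>.\<close>
  define P where "P D \<longleftrightarrow> D \<subseteq> Q' \<and> \<theta> * ?m D \<le> ?m (E \<inter> D)" for D
  let ?\<D> = "stopping a l P"
  have Q: "is_cube Q"
    unfolding Q_def is_cube_def using \<open>0 < l\<close> by (intro exI[of _ a] exI[of _ l]) auto
  have E: "E \<in> lmeasurable" and F: "F \<in> lmeasurable"
    using superlevel_lmeasurable[OF Q u] by (auto simp: E_def F_def)
  have FE: "F \<subseteq> E" and EQ: "E \<subseteq> Q"
    using superlevel_antimono[of t "t + \<delta>"] \<open>0 < \<delta>\<close> by (auto simp: E_def F_def superlevel_def)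
  have \<theta>: "0 < \<theta>" "\<theta> < 1"
    unfolding \<theta>_def by (auto simp: less_1_mult simp del: power_Suc intro: one_less_power)
  have sub: "dyadic a l n x \<subseteq> Q'" if "x \<in> Q'" for n x
    using dyadic_antimono[of 0 n a l x] dyadic_eq[of x a l 0 a] that by (simp add: Q'_def)
  have dm: "dyadic a l n x \<in> lmeasurable" for n x
    using \<open>0 < l\<close> by (rule dyadic_lmeasurable)
  have D_sets: "D \<in> sets lebesgue" if "D \<in> ?\<D>" for D
    using that dm by (auto simp: stopping_def)
  then have G: "\<Union>?\<D> \<in> sets lebesgue"
    by (intro sets.countable_Union countable_stopping) auto
  have Q': "negligible (Q - Q')" "Q' \<in> lmeasurable"
    using between_box_cbox(1,3)[OF dyadic_zero_sandwich[OF \<open>0 < l\<close>, of a]] by (auto simp: Q'_def Q_def)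

  \<comment> \<open>A point that no stopping cell contains has only cells in which \<open>E\<close>
    has density below \<theta>, so the density argument applies.\<close>
  have "negligible (E \<inter> Q' - \<Union>?\<D>)"
  proof (rule negligible_if_thin_dyadic[OF \<open>0 < l\<close>])
    show "E \<inter> Q' - \<Union>?\<D> \<in> lmeasurable"
      using E Q'(2) G by (intro fmeasurable.Diff fmeasurable_Diff fmeasurable.Int) auto
    fix n x assume x: "x \<in> E \<inter> Q' - \<Union>?\<D>"
    then have "\<not> P (dyadic a l n x)"
      using stopping_covers[of P a l n x] by blast
    then have "?m (E \<inter> dyadic a l n x) \<le> \<theta> * ?m (dyadic a l n x)"
      using sub x by (auto simp: P_def)
    moreover have "?m ((E \<inter> Q' - \<Union>?\<D>) \<inter> dyadic a l n x) \<le> ?m (E \<inter> dyadic a l n x)"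
      using E Q'(2) G dm[of n x] by (intro measure_mono_fmeasurable) auto
    ultimately show "?m ((E \<inter> Q' - \<Union>?\<D>) \<inter> dyadic a l n x) \<le> \<theta> * ?m (dyadic a l n x)"
      by linarith
  qed (use \<theta> in auto)
  then have "negligible ((E \<inter> Q' - \<Union>?\<D>) \<union> (Q - Q'))"
    using Q'(1) by (rule negligible_Un)
  \<comment> \<open>What the stopping cells miss of \<open>F\<close> lies in the null part of
    \<open>E\<close> just treated or on the upper faces \<open>Q - Q'\<close>.\<close>
  then have "negligible (F - F \<inter> \<Union>?\<D> \<union> (F \<inter> \<Union>?\<D> - F))"
    by (rule negligible_subset) (use FE EQ in blast)
  then have "?m F = ?m (F \<inter> \<Union>?\<D>)"
    using measure_negligible_symdiff[OF F] by metis
  also have "\<dots> \<le> 1 / 2 * ?m E"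
  proof (rule measure_le_by_partition[OF countable_stopping disjoint_stopping D_sets])
    show "F \<inter> \<Union>?\<D> \<in> lmeasurable"
      using F G by (rule fmeasurable_Int_fmeasurable)
    fix D assume D: "D \<in> ?\<D>"
    then obtain n x where n: "D = dyadic a l n x" "P D" "\<forall>k<n. \<not> P (dyadic a l k x)"
      unfolding stopping_def by blast
    have "x \<in> Q'"
      using n(1,2) dyadic_self[of x a l n] by (auto simp: P_def)
    obtain C where C: "is_cube C" "C \<subseteq> Q" "D \<subseteq> C" "negligible (C - D)" "C \<in> lmeasurable" "?m C = ?m D"
      using dyadic_closed_cube[of l x a n] \<open>0 < l\<close> \<open>x \<in> Q'\<close> unfolding n(1) Q'_def Q_def by metis
    have D_pos: "0 < ?m D"
      using \<open>0 < l\<close> by (simp add: n(1) measure_dyadic)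
    have eq: "?m (E \<inter> C) = ?m (E \<inter> D)"
    proof (rule measure_negligible_symdiff)
      show "E \<inter> D \<in> lmeasurable"
        using E dm[of n x] n(1) by auto
      show "negligible (E \<inter> D - E \<inter> C \<union> (E \<inter> C - E \<inter> D))"
        by (rule negligible_subset[OF C(4)]) (use C(3) in blast)
    qed
    have "C = Q \<or> ?m (E \<inter> C) \<le> ?m C / 2"
    proof (cases n)
      \<comment> \<open>A cell of level 0 has no parent to bound its density; its closed cube is all
        of \<open>Q\<close>, where the mean is used instead.\<close>
      case 0
      have "D = Q'"
        using 0 n(1) dyadic_eq[of x a l 0 a] \<open>x \<in> Q'\<close> by (simp add: Q'_def)
      have "Q \<subseteq> C"
      proof -
        have "closure (box a (\<chi> i. a $ i + l)) \<subseteq> C"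
          using C(1,3) dyadic_zero_sandwich(1)[OF \<open>0 < l\<close>, of a] \<open>D = Q'\<close>
          by (intro closure_minimal) (auto simp: is_cube_def Q'_def)
        moreover have "box a (\<chi> i. a $ i + l) \<noteq> {}"
          using \<open>0 < l\<close> by (simp add: interval_eq_empty_cart not_le)
        ultimately show ?thesis
          by (simp add: closure_box Q_def)
      qed
      then show ?thesis
        using C(2) by blast
    next
      case (Suc k)
      then have "\<not> P (dyadic a l k x)"
        using n(3) by simp
      then have "?m (E \<inter> dyadic a l k x) \<le> \<theta> * ?m (dyadic a l k x)"
        using sub[OF \<open>x \<in> Q'\<close>] by (simp add: P_def)
      also have "\<dots> = ?m D / 2"
        using \<open>0 < l\<close> by (simp add: n(1) Suc measure_dyadic \<theta>_def power_divide power_mult_distrib)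
      finally have "?m (E \<inter> dyadic a l k x) \<le> ?m C / 2"
        using C(6) by simp
      moreover have "?m (E \<inter> D) \<le> ?m (E \<inter> dyadic a l k x)"
        using E dm dyadic_antimono[of k n a l x] Suc n(1)
        by (intro measure_mono_fmeasurable) auto
      ultimately show ?thesis
        using eq by linarith
    qed
    then have "\<delta> * ?m (F \<inter> C) \<le> 2 * real_of_ereal (BMO_norm Q u) * ?m C"
      using measure_superlevel_cube_le[OF Q u C(1,2) _ \<open>0 \<le> t\<close> \<open>0 < \<delta>\<close>] D_pos C(6)
      by (simp add: E_def F_def)
    \<comment> \<open>The exponent \<open>CARD('n) + 3\<close> in \<delta> is chosen for this: twice
      the norm is \<delta> times \<theta> / 2, half of the stopping density.\<close>
    also have "\<dots> = \<delta> * (\<theta> / 2 * ?m D)"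
      by (simp add: \<delta>(1) \<theta>_def C(6) power_add)
    finally have "?m (F \<inter> C) \<le> \<theta> / 2 * ?m D"
      using \<open>0 < \<delta>\<close> by simp
    moreover have "?m (F \<inter> \<Union>?\<D> \<inter> D) \<le> ?m (F \<inter> C)"
      using F G C(3,5) D_sets[OF D] by (intro measure_mono_fmeasurable) auto
    moreover have "\<theta> * ?m D \<le> ?m (E \<inter> D)"
      using n(2) by (simp add: P_def)
    ultimately show "?m (F \<inter> \<Union>?\<D> \<inter> D) \<le> 1 / 2 * ?m (E \<inter> D)"
      by linarith
  qed (use E in auto)
  finally show ?thesis
    by (simp add: E_def F_def)
qed

section \<open>From halving to exponential decay\<close>

text \<open>Halve as often as whole steps \<delta> fit between \<eta> and \<sigma>; monotonicity
  bridges the incomplete last step, at the price of the factor 2.\<close>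

lemma exponential_decay_of_halving:
  fixes \<phi> :: "real \<Rightarrow> real"
  assumes anti: "\<And>s t. s \<le> t \<Longrightarrow> \<phi> t \<le> \<phi> s" and nonneg: "\<And>s. 0 \<le> \<phi> s"
    and half: "\<And>t. 0 \<le> t \<Longrightarrow> \<phi> (t + \<delta>) \<le> 1 / 2 * \<phi> t" and "0 < \<delta>" "0 \<le> \<eta>" "\<eta> \<le> \<sigma>"
  shows "\<phi> \<sigma> \<le> 2 * exp (- ln 2 * ((\<sigma> - \<eta>) / \<delta>)) * \<phi> \<eta>"
proof -
  have iter: "\<phi> (\<eta> + real k * \<delta>) \<le> \<phi> \<eta> / 2 ^ k" for k
  proof (induction k)
    case (Suc k)
    have "\<phi> (\<eta> + real (Suc k) * \<delta>) = \<phi> ((\<eta> + real k * \<delta>) + \<delta>)"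
      by (simp add: algebra_simps)
    also have "\<dots> \<le> 1 / 2 * \<phi> (\<eta> + real k * \<delta>)"
      using \<open>0 < \<delta>\<close> \<open>0 \<le> \<eta>\<close> by (intro half) auto
    finally show ?case
      using Suc.IH by simp
  qed simp
  define s where "s = (\<sigma> - \<eta>) / \<delta>"
  define k where "k = nat \<lfloor>s\<rfloor>"
  have "0 \<le> s"
    using assms by (simp add: s_def)
  then have k: "real k \<le> s" "s < real k + 1"
    unfolding k_def by (auto simp: of_nat_nat)
  have "real k * \<delta> \<le> \<sigma> - \<eta>"
    using k(1) \<open>0 < \<delta>\<close> by (simp add: s_def field_simps)
  then have "\<phi> \<sigma> \<le> \<phi> (\<eta> + real k * \<delta>)"
    by (intro anti) simp
  also have "\<dots> \<le> \<phi> \<eta> / 2 ^ k"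
    by (rule iter)
  \<comment> \<open>One more halving is written in and paid for by the factor 2, since
    \<open>k + 1\<close>, unlike \<open>k\<close>, exceeds \<open>s\<close>.\<close>
  also have "\<dots> = 2 * exp (- ln 2 * (real k + 1)) * \<phi> \<eta>"
  proof -
    have "exp (ln 2 * (real k + 1)) = (2 :: real) * 2 ^ k"
      by (simp add: distrib_left exp_add mult.commute[of "ln 2"] exp_of_nat_mult)
    then have "exp (- ln 2 * (real k + 1)) = 1 / ((2 :: real) * 2 ^ k)"
      unfolding mult_minus_left exp_minus by (simp only: inverse_eq_divide)
    then show ?thesis
      by (simp only:) simp
  qed
  also have "\<dots> \<le> 2 * exp (- ln 2 * s) * \<phi> \<eta>"
    using k(2) nonneg by (intro mult_right_mono mult_left_mono) auto
  finally show ?thesis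
    by (simp add: s_def)
qed

theorem theorem1p2:
  "\<exists>\<gamma> \<alpha>. 0 < \<gamma> \<and> 0 < \<alpha> \<and>
     (\<forall>(Q :: (real ^ 'n) set) (u :: real ^ 'n \<Rightarrow> real).
        is_cube Q \<longrightarrow> in_BMO Q u \<longrightarrow>
        (\<forall>\<eta> \<sigma>. 0 \<le> \<eta> \<longrightarrow> \<eta> \<le> \<sigma> \<longrightarrow>
           measure lebesgue (superlevel Q u \<sigma>)
             \<le> \<gamma> * exp (- \<alpha> * ((\<sigma> - \<eta>) / real_of_ereal (BMO_norm Q u)))
                 * measure lebesgue (superlevel Q u \<eta>)))"
proof (intro exI conjI allI impI)
  \<comment> \<open>The witness for \<gamma> is the cost of the incomplete last step; that for
    \<alpha> is \<open>ln 2\<close> divided by the ratio of the halving step to the norm.\<close>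
  show "0 < (2 :: real)" "0 < ln (2 :: real) / 2 ^ (CARD('n) + 3)"
    by auto
  fix Q :: "(real ^ 'n) set" and u :: "real ^ 'n \<Rightarrow> real" and \<eta> \<sigma> :: real
  assume Q: "is_cube Q" and u: "in_BMO Q u" and "0 \<le> \<eta>" "\<eta> \<le> \<sigma>"
  let ?m = "measure lebesgue"
  define M where "M = real_of_ereal (BMO_norm Q u)"
  have "0 \<le> M"
    using BMO_norm_nonneg[OF Q] by (simp add: M_def real_of_ereal_pos)
  obtain a l where al: "0 \<le> l" "Q = cbox a (\<chi> i. a $ i + l)"
    using Q by (auto simp: is_cube_def)
  have anti: "?m (superlevel Q u t) \<le> ?m (superlevel Q u s)" if "s \<le> t" for s t
    using Q u that by (rule measure_superlevel_antimono)
  show "?m (superlevel Q u \<sigma>) \<le> 2 * exp (- (ln 2 / 2 ^ (CARD('n) + 3)) *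
      ((\<sigma> - \<eta>) / real_of_ereal (BMO_norm Q u))) * ?m (superlevel Q u \<eta>)"
  \<comment> \<open>Degenerate cases are separated: for \<open>M = 0\<close> the quotient is 0 by
    convention, the exponential is 1 and monotonicity suffices; for \<open>l = 0\<close> the cube is
    a point of measure 0.\<close>
  proof (cases "M = 0 \<or> l = 0")
    case False
    then have "0 < l" "0 < 2 ^ (CARD('n) + 3) * M"
      using al(1) \<open>0 \<le> M\<close> by auto
    then have "?m (superlevel Q u \<sigma>)
        \<le> 2 * exp (- ln 2 * ((\<sigma> - \<eta>) / (2 ^ (CARD('n) + 3) * M))) * ?m (superlevel Q u \<eta>)"
      using anti \<open>0 \<le> \<eta>\<close> \<open>\<eta> \<le> \<sigma>\<close> measure_superlevel_halving[OF _ al(2) u]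
      by (intro exponential_decay_of_halving) (auto simp: M_def)
    then show ?thesis
      by (simp add: M_def)
  next
    case True
    then show ?thesis
    proof
      assume "M = 0"
      then show ?thesis
        using anti[OF \<open>\<eta> \<le> \<sigma>\<close>] measure_nonneg[of lebesgue "superlevel Q u \<eta>"]
        unfolding M_def[symmetric] by (simp del: measure_nonneg)
    next
      assume "l = 0"
      have "?m (superlevel Q u \<sigma>) \<le> ?m Q"
        using is_cube_lmeasurable[OF Q] fmeasurableD[OF superlevel_lmeasurable[OF Q u]]
        by (intro measure_mono_fmeasurable) (auto simp: superlevel_def)
      also have "\<dots> = 0"
        using measure_cube[of 0 a] \<open>l = 0\<close> al(2) by simp
      finally have "?m (superlevel Q u \<sigma>) \<le> 0" .
      then show ?thesis
        by (smt (verit) exp_gt_zero measure_nonneg mult_nonneg_nonneg)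
    qed
  qed
qed

end
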